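(* Let $n,t,d\ge 1$ be integers with $n>3t$. For $n$ clients with vectors in $\mathbb{R}^d$, up to $t$ of which are Byzantine, satisfying strong validity is not a sufficient condition for an aggregation algorithm to achieve a bounded approximation ratio of $\mathrm{Cent}^\star$: there exists an aggregation algorithm that satisfies strong validity but, for every $\alpha<\infty$, does not compute an $\alpha$-approximation of the centroid.
   Context: Model. There are $n$ clients, up to $t<n/3$ of which are Byzantine, and one trusted server. The server receives a family of $m$ vectors $(v_i)_{i\in M}$ in $\mathbb{R}^d$ (Euclidean norm and distance $\mathrm{dist}$), where $M\subseteq\{1,\dots,n\}$, $|M|=m$, $n-t\le m\le n$. An unknown set $N\subseteq M$ with $|N|\ge n-t$ is the set of non-faulty clients; the vectors of the clients in $M\setminus N$ are Byzantine and arbitrary (Byzantine clients may also send nothing). An aggregation algorithm $\mathcal{A}$ is a deterministic function of the received family only (it does not know $N$); its output is a vector in $\mathbb{R}^d$. A received family together with an admissible set $N$ is called a configuration. True centroid: $\mathrm{Cent}^\star=\frac1{|N|}\sum_{i\in N}v_i$. Candidate centroids: $S_{\mathrm{Cent}}$ is the set of all averages $\frac{1}{n-t}\sum_{i\in I}v_i$ with $I\subseteq M$, $|I|=n-t$. Let $\mathrm{Rad_{cov}}$ be the radius of the smallest closed Euclidean ball containing $S_{\mathrm{Cent}}$. Approximation: $\mathcal{A}$ computes an $\alpha$-approximation of the centroid if, in every configuration, its output $O$ satisfies $\mathrm{dist}(O,\mathrm{Cent}^\star)\le\alpha\cdot\mathrm{Rad_{cov}}$. Strong validity: in every configuration in which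 all non-faulty vectors $v_i$, $i\in N$, are equal to a single vector $v$, the output of $\mathcal{A}$ is $v$. *)

theory Defs imports "HOL-Analysis.Analysis" begin

text \<open>
  A received family is a partial map \<open>V\<close> from client identifiers to vectors: its domain is the
  set \<open>M\<close> of clients whose vector arrived. As an algorithm's only argument is \<open>V\<close>, it knows who
  sent which vector but not which clients are faulty.
\<close>

type_synonym 'd received = "nat \<rightharpoonup> real ^ 'd"
type_synonym 'd aggregation = "'d received \<Rightarrow> real ^ 'd"

definition configuration :: "nat \<Rightarrow> nat \<Rightarrow> 'd::finite received \<Rightarrow> nat set \<Rightarrow> bool" where
  "configuration n t V N \<longleftrightarrow>
     dom V \<subseteq> {1..n} \<and> n - t \<le> card (dom V) \<and> N \<subseteq> dom V \<and> n - t \<le> card N"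

definition true_centroid :: "'d::finite received \<Rightarrow> nat set \<Rightarrow> real ^ 'd" where
  "true_centroid V N = (1 / real (card N)) *\<^sub>R (\<Sum>i\<in>N. the (V i))"

definition candidate_centroids :: "nat \<Rightarrow> nat \<Rightarrow> 'd::finite received \<Rightarrow> (real ^ 'd) set" where
  "candidate_centroids n t V =
     {(1 / real (n - t)) *\<^sub>R (\<Sum>i\<in>I. the (V i)) | I. I \<subseteq> dom V \<and> card I = n - t}"

text \<open>
  The radius of the smallest enclosing closed ball, written as an infimum; the infimum is attained
  for nonempty bounded sets (lemma \<open>smallest_enclosing_ball\<close>). The condition \<open>0 \<le> r\<close> excludes
  negative \<open>r\<close>, for which \<open>cball c r\<close> is empty.
\<close>

definition enclosing_radius :: "'a::euclidean_space set \<Rightarrow> real" where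
  "enclosing_radius S = Inf {r. 0 \<le> r \<and> (\<exists>c. S \<subseteq> cball c r)}"

lemma smallest_enclosing_ball:
  fixes S :: "'a::euclidean_space set"
  assumes "bounded S" and "S \<noteq> {}"
  shows "\<exists>c. S \<subseteq> cball c (enclosing_radius S)"
    and "0 \<le> enclosing_radius S"
    and "\<And>c r. S \<subseteq> cball c r \<Longrightarrow> enclosing_radius S \<le> r"
proof -
  let ?R = "{r. 0 \<le> r \<and> (\<exists>c. S \<subseteq> cball c r)}"
  obtain x0 where x0: "x0 \<in> S" using assms by blast
  have nonneg: "0 \<le> r" if "S \<subseteq> cball c r" for c r
    using that x0 order_trans[OF zero_le_dist, of c x0 r] by auto
  obtain c0 r0 where "S \<subseteq> cball c0 r0" using assms bounded_subset_cball by blast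
  then have c0: "S \<subseteq> cball c0 r0" "0 \<le> r0"
    using nonneg by auto
  define K where "K = {p. (\<forall>x\<in>S. dist (fst p) x \<le> snd p)} \<inter> (cball x0 r0 \<times> {0..r0})"
  have "closed {p :: 'a \<times> real. \<forall>x\<in>S. dist (fst p) x \<le> snd p}"
    unfolding Ball_def
    by (intro closed_Collect_all closed_Collect_imp closed_Collect_le continuous_intros) auto
  then have "compact K"
    unfolding K_def by (intro closed_Int_compact compact_Times) auto
  moreover have "(c0, r0) \<in> K"
    using c0 x0 by (auto simp: K_def dist_commute)
  ultimately obtain p where p: "p \<in> K" "\<And>q. q \<in> K \<Longrightarrow> snd p \<le> snd q"
    using continuous_attains_inf[of K snd] continuous_on_snd[OF continuous_on_id] by blast
  have pR: "0 \<le> snd p" "S \<subseteq> cball (fst p) (snd p)"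
    using p(1) by (auto simp: K_def)
  have min: "snd p \<le> r" if "S \<subseteq> cball c r" for c r
  proof (cases "r \<le> r0")
    case True
    have "0 \<le> r" using that by (rule nonneg)
    then have "(c, r) \<in> K" using that x0 True by (fastforce simp: K_def dist_commute)
    then show ?thesis using p(2) by force
  next
    case False
    then show ?thesis using p(1) by (auto simp: K_def)
  qed
  have eq: "enclosing_radius S = snd p"
    unfolding enclosing_radius_def using pR min by (intro cInf_eq_minimum) auto
  show "\<exists>c. S \<subseteq> cball c (enclosing_radius S)" "0 \<le> enclosing_radius S"
    using pR eq by auto
  show "\<And>c r. S \<subseteq> cball c r \<Longrightarrow> enclosing_radius S \<le> r"
    using min eq by auto
qed

definition rad_cov :: "nat \<Rightarrow> nat \<Rightarrow> 'd::finite received \<Rightarrow> real" where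
  "rad_cov n t V = enclosing_radius (candidate_centroids n t V)"

definition approximates_centroid :: "nat \<Rightarrow> nat \<Rightarrow> real \<Rightarrow> 'd::finite aggregation \<Rightarrow> bool" where
  "approximates_centroid n t \<alpha> A \<longleftrightarrow>
     (\<forall>V N. configuration n t V N \<longrightarrow> dist (A V) (true_centroid V N) \<le> \<alpha> * rad_cov n t V)"

definition strong_validity :: "nat \<Rightarrow> nat \<Rightarrow> 'd::finite aggregation \<Rightarrow> bool" where
  "strong_validity n t A \<longleftrightarrow>
     (\<forall>V N v. configuration n t V N \<and> (\<forall>i\<in>N. V i = Some v) \<longrightarrow> A V = v)"

end

theory Submission imports Defs begin

text \<open>
  Output the vector that at least \<open>n - t\<close> clients sent, if there is one, and \<open>0\<close> otherwise; it is
  unique since \<open>2 * (n - t) > n\<close>, so strong validity holds. If exactly \<open>n - t\<close> vectors arrive,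
  then there is a single candidate centroid and the covering radius is \<open>0\<close>, so any positive
  error rules out every ratio. Such an error occurs when one of these vectors is nonzero and all
  others are \<open>0\<close>.
\<close>

definition supermajority :: "nat \<Rightarrow> nat \<Rightarrow> 'd::finite received \<Rightarrow> real ^ 'd \<Rightarrow> bool" where
  "supermajority n t V v \<longleftrightarrow> n - t \<le> card {i. V i = Some v}"

text \<open>The description operator is meaningful only where the supermajority vector is unique;
  \<open>supermajority_unique\<close> guarantees this for every family with senders in
  \<open>{1..n}\<close>, so for every configuration.\<close>

definition supermajority_rule :: "nat \<Rightarrow> nat \<Rightarrow> 'd::finite aggregation" where
  "supermajority_rule n t V =
     (if \<exists>v. supermajority n t V v then THE v. supermajority n t V v else 0)"

lemma supermajority_unique:
  fixes V :: "'d::finite received"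
  assumes "n > 2 * t" and dom: "dom V \<subseteq> {1..n}"
    and v: "supermajority n t V v" and w: "supermajority n t V w"
  shows "v = w"
proof (rule ccontr)
  let ?S = "\<lambda>u. {i. V i = Some u}"
  assume "v \<noteq> w"
  have sub: "?S u \<subseteq> {1..n}" for u
    using dom by blast
  have fin: "finite (?S u)" for u
    using finite_subset[OF sub] by simp
  \<comment> \<open>Since \<open>V\<close> is a function, no client sends two different vectors, so
    the two sender sets are disjoint.\<close>
  have "card (?S v) + card (?S w) = card (?S v \<union> ?S w)"
    using \<open>v \<noteq> w\<close> by (subst card_Un_disjoint[OF fin fin]) auto
  also have "\<dots> \<le> n"
    using card_mono[of "{1..n}" "?S v \<union> ?S w"] sub by simp
  finally show False
    using v w \<open>n > 2 * t\<close> unfolding supermajority_def by linarith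
qed

lemma strong_validity_supermajority_rule:
  assumes "n > 2 * t"
  shows "strong_validity n t (supermajority_rule n t :: 'd::finite aggregation)"
  unfolding strong_validity_def
proof (intro allI impI, elim conjE)
  fix V :: "'d received" and N v
  assume conf: "configuration n t V N" and N: "\<forall>i\<in>N. V i = Some v"
  have dom: "dom V \<subseteq> {1..n}" and "n - t \<le> card N"
    using conf by (auto simp: configuration_def)
  have "{i. V i = Some v} \<subseteq> {1..n}"
    using dom by blast
  then have "finite {i. V i = Some v}"
    by (rule finite_subset) simp
  \<comment> \<open>The inclusion may be strict: Byzantine clients may send \<open>v\<close>
    too.\<close>
  then have "card N \<le> card {i. V i = Some v}"
    using N by (intro card_mono) auto
  with \<open>n - t \<le> card N\<close> have v: "supermajority n t V v"
    by (simp add: supermajority_def)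
  then have "(THE v. supermajority n t V v) = v"
    using supermajority_unique[OF assms dom] by blast
  with v show "supermajority_rule n t V = v"
    by (auto simp: supermajority_rule_def)
qed

text \<open>Only \<open>I = dom V\<close> has the required size, so the candidate set is a single
  point, enclosed by a ball of radius 0.\<close>

lemma rad_cov_eq_0:
  fixes V :: "'d::finite received"
  assumes "finite (dom V)" and "card (dom V) = n - t"
  shows "rad_cov n t V = 0"
proof -
  have "I \<subseteq> dom V \<and> card I = n - t \<longleftrightarrow> I = dom V" for I
    using assms by (metis card_subset_eq order_refl)
  then obtain c where c: "candidate_centroids n t V = {c}"
    unfolding candidate_centroids_def by simp
  have "0 \<le> enclosing_radius {c}" "enclosing_radius {c} \<le> 0"
    using smallest_enclosing_ball(2,3)[of "{c}"] by force+
  then show ?thesis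
    by (simp add: rad_cov_def c)
qed

lemma not_approximates_supermajority_rule:
  assumes "n - t \<ge> 2"
  shows "\<not> approximates_centroid n t \<alpha> (supermajority_rule n t :: 'd::finite aggregation)"
proof
  assume approx: "approximates_centroid n t \<alpha> (supermajority_rule n t :: 'd aggregation)"
  \<comment> \<open>The all-ones vector is nonzero in every dimension.\<close>
  define e :: "real ^ 'd" where "e = 1"
  define V :: "'d received"
    where "V i = (if i \<in> {1..n - t} then Some (if i = 1 then e else 0) else None)" for i
  have "e \<noteq> 0"
    by (simp add: e_def)
  have dom: "dom V = {1..n - t}"
    by (auto simp: V_def dom_def)
  have "\<not> supermajority n t V v" for v
  proof
    assume "supermajority n t V v"
    moreover have "{i. V i = Some v} \<subseteq> dom V"
      by auto
    ultimately have "{i. V i = Some v} = dom V"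
      \<comment> \<open>Only \<open>n - t\<close> vectors arrived, so a supermajority must be
        unanimous; clients 1 and 2 disagree.\<close>
      using card_seteq[of "dom V" "{i. V i = Some v}"] by (simp add: supermajority_def dom)
    moreover have "{1, 2} \<subseteq> dom V"
      using assms by (simp add: dom)
    ultimately have "V 1 = Some v" "V 2 = Some v"
      by auto
    then show False
      using assms \<open>e \<noteq> 0\<close> by (auto simp: V_def)
  qed
  then have out: "supermajority_rule n t V = 0"
    by (simp add: supermajority_rule_def)
  have "(\<Sum>i\<in>dom V. the (V i)) = (\<Sum>i\<in>{1..n - t}. if i = 1 then e else 0)"
    by (intro sum.cong) (auto simp: dom V_def)
  also have "\<dots> = e"
    using assms by simp
  finally have "true_centroid V (dom V) \<noteq> 0"
    using assms \<open>e \<noteq> 0\<close> by (simp add: true_centroid_def dom)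
  \<comment> \<open>All senders count as non-faulty: the true centroid is \<open>e\<close> divided
    by \<open>n - t\<close>, the output is 0, and the permitted error is
    \<open>\<alpha> * 0\<close>.\<close>
  moreover have "configuration n t V (dom V)"
    by (auto simp: configuration_def dom)
  ultimately show False
    using approx rad_cov_eq_0[of V n t] by (force simp: approximates_centroid_def out dom)
qed

theorem lemma3p2:
  fixes n t :: nat
  assumes "n \<ge> 1" and "t \<ge> 1" and "n > 3 * t"
  shows "\<exists>A :: 'd::finite aggregation.
           strong_validity n t A \<and> (\<forall>\<alpha>::real. \<not> approximates_centroid n t \<alpha> A)"
proof -
  have "n > 2 * t" "n - t \<ge> 2"
    using assms by linarith+
  then show ?thesis
    using strong_validity_supermajority_rule not_approximates_supermajority_rule by blast
qed

end
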